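(* For every integer $n\ge 1$, $\operatorname{th}_{\gamma_P}(P_n)=\left\lceil\sqrt{2n}-\frac12\right\rceil$, and for every integer $n\ge 3$, $\operatorname{th}_{\gamma_P}(C_n)=\left\lceil\sqrt{2n}-\frac12\right\rceil$, where $P_n$ and $C_n$ denote the path and the cycle on $n$ vertices.
   Context: All graphs are finite, simple, undirected, and have at least one vertex. For $S\subseteq V(G)$, $N[S]$ is the set of vertices in $S$ or adjacent to a vertex of $S$. Given $G=(V,E)$ and $S\subseteq V$, initially (timestep $0$) the vertices of $S$ are colored; in timestep $1$ every vertex in $N[S]$ becomes colored; in each subsequent timestep, every vertex which is the only non-colored neighbor of some colored vertex becomes colored. $S$ is a power dominating set if all vertices eventually become colored, and then $\operatorname{ppt}(G;S)$ is the number of timesteps needed to color all of $G$ (so $\operatorname{ppt}(G;V)=0$). The power domination throttling number is $\operatorname{th}_{\gamma_P}(G)=\min\{|S|+\operatorname{ppt}(G;S): S \text{ a power dominating set of } G\}$. *)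

theory Defs
  imports Complex_Main "Graph_Theory.Pair_Digraph"
begin

text \<open>
  A finite simple undirected graph is a \<^locale>\<open>pair_graph\<close>: the arc relation is symmetric and
  loop-free, and the edge between \<open>u\<close> and \<open>v\<close> is given by the two arcs \<open>(u, v)\<close> and \<open>(v, u)\<close>.
\<close>

definition neighbors :: "'a pair_pre_digraph \<Rightarrow> 'a \<Rightarrow> 'a set" where
  "neighbors G v = {w \<in> pverts G. (v, w) \<in> parcs G}"

definition closed_neighborhood :: "'a pair_pre_digraph \<Rightarrow> 'a set \<Rightarrow> 'a set" where
  "closed_neighborhood G S = S \<union> (\<Union>v\<in>S. neighbors G v)"

definition force_step :: "'a pair_pre_digraph \<Rightarrow> 'a set \<Rightarrow> 'a set" where
  "force_step G C = C \<union> {w. \<exists>v\<in>C. neighbors G v - C = {w}}"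

fun colored :: "'a pair_pre_digraph \<Rightarrow> 'a set \<Rightarrow> nat \<Rightarrow> 'a set" where
  "colored G S 0 = S"
| "colored G S (Suc 0) = closed_neighborhood G S"
| "colored G S (Suc (Suc t)) = force_step G (colored G S (Suc t))"

definition power_dominating_set :: "'a pair_pre_digraph \<Rightarrow> 'a set \<Rightarrow> bool" where
  "power_dominating_set G S \<longleftrightarrow> S \<subseteq> pverts G \<and> (\<exists>t. colored G S t = pverts G)"

text \<open>Only meaningful when \<open>S\<close> is a power dominating set of \<open>G\<close>.\<close>
definition ppt :: "'a pair_pre_digraph \<Rightarrow> 'a set \<Rightarrow> nat" where
  "ppt G S = (LEAST t. colored G S t = pverts G)"

definition pd_throttling :: "'a pair_pre_digraph \<Rightarrow> nat" where
  "pd_throttling G = Min {card S + ppt G S | S. power_dominating_set G S}"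

text \<open>The minimum is taken over a finite nonempty set.\<close>
lemma pd_throttling_set:
  assumes "finite (pverts G)"
  shows "finite {card S + ppt G S | S. power_dominating_set G S}"
    and "{card S + ppt G S | S. power_dominating_set G S} \<noteq> {}"
proof -
  have "finite {S. power_dominating_set G S}"
    by (rule finite_subset[of _ "Pow (pverts G)"])
      (use assms in \<open>auto simp: power_dominating_set_def\<close>)
  then show "finite {card S + ppt G S | S. power_dominating_set G S}"
    by simp
  have "power_dominating_set G (pverts G)"
    unfolding power_dominating_set_def by (auto intro: exI[of _ 0])
  then show "{card S + ppt G S | S. power_dominating_set G S} \<noteq> {}"
    by blast
qed

definition path_graph :: "nat \<Rightarrow> nat pair_pre_digraph" where
  "path_graph n = \<lparr> pverts = {..<n},
     parcs = {(i, j). i < n \<and> j < n \<and> (j = i + 1 \<or> i = j + 1)} \<rparr>"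

text \<open>The cycle on \<open>n\<close> vertices only for \<open>n \<ge> 3\<close>: there is a loop for \<open>n = 1\<close> and a single edge
  for \<open>n = 2\<close>.\<close>
definition cycle_graph :: "nat \<Rightarrow> nat pair_pre_digraph" where
  "cycle_graph n = \<lparr> pverts = {..<n},
     parcs = {(i, j). i < n \<and> j < n \<and> (j = (i + 1) mod n \<or> i = (j + 1) mod n)} \<rparr>"

lemma pair_graph_path_graph: "pair_graph (path_graph n)"
proof
  show "finite (parcs (path_graph n))"
    by (rule finite_subset[of _ "{..<n} \<times> {..<n}"]) (auto simp: path_graph_def)
  show "symmetric (with_proj (path_graph n))"
    by (auto simp: path_graph_def symmetric_conv)
qed (auto simp: path_graph_def)

lemma pair_graph_cycle_graph:
  assumes "n \<ge> 3"
  shows "pair_graph (cycle_graph n)"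
proof
  show "finite (parcs (cycle_graph n))"
    by (rule finite_subset[of _ "{..<n} \<times> {..<n}"]) (auto simp: cycle_graph_def)
  show "symmetric (with_proj (cycle_graph n))"
    by (auto simp: cycle_graph_def symmetric_conv)
  show "fst e \<noteq> snd e" if "e \<in> parcs (cycle_graph n)" for e
    using that assms by (auto simp: cycle_graph_def mod_Suc split: if_splits)
qed (auto simp: cycle_graph_def)

end

theory Submission
  imports Defs
begin

text \<open>
  In a path or a cycle, a set of \<open>s\<close> vertices colors at most \<open>s (2 t + 1)\<close> vertices within
  \<open>t\<close> timesteps, since the color advances by at most one vertex per step in each of two directions.
  Hence \<open>2 n \<le> 2 s (2 t + 1) \<le> (s + t + 1 / 2)\<^sup>2\<close> by the arithmetic-geometric mean inequality.
  Conversely, for \<open>k = \<lceil>sqrt (2 n) - 1 / 2\<rceil>\<close> the choice \<open>s = \<lceil>k / 2\<rceil>\<close>, \<open>t = \<lfloor>k / 2\<rfloor>\<close>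
  makes \<open>s (2 t + 1) = k (k + 1) / 2 \<ge> n\<close>, and the centers of \<open>s\<close> consecutive blocks of
  \<open>2 t + 1\<close> vertices color every vertex within \<open>t\<close> steps.
\<close>

text \<open>Treats both graphs at once: consecutive vertices must be adjacent, and every arc must be
  one of the cyclic graph. The only freedom left is a wrap-around arc between \<open>0\<close> and
  \<open>n - 1\<close>.\<close>

locale path_or_cycle =
  fixes G :: "nat pair_pre_digraph" and n :: nat
  assumes pos: "n \<ge> 1"
    and verts: "pverts G = {..<n}"
    and right_neighbor: "i + 1 < n \<Longrightarrow> i + 1 \<in> neighbors G i"
    and left_neighbor: "i + 1 < n \<Longrightarrow> i \<in> neighbors G (i + 1)"
    and neighbors_cyclic: "w \<in> neighbors G v \<Longrightarrow> v < n \<and> (w = (v + 1) mod n \<or> v = (w + 1) mod n)"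
begin

lemma neighbor_less: "w \<in> neighbors G v \<Longrightarrow> w < n"
  using verts by (auto simp: neighbors_def)

text \<open>Away from \<open>0\<close> and \<open>n - 1\<close> no wrap-around arc can occur, so the
  upper and lower bounds on adjacency coincide.\<close>

lemma neighbors_interior:
  assumes "i + 2 < n"
  shows "neighbors G (i + 1) = {i, i + 2}"
proof
  show "neighbors G (i + 1) \<subseteq> {i, i + 2}"
  proof
    fix w assume w: "w \<in> neighbors G (i + 1)"
    then show "w \<in> {i, i + 2}"
      using neighbors_cyclic[OF w] neighbor_less[OF w] assms by (auto simp: mod_Suc split: if_splits)
  qed
  show "{i, i + 2} \<subseteq> neighbors G (i + 1)"
    using assms left_neighbor[of i] right_neighbor[of "i + 1"] by auto
qed

text \<open>Forgets the forcing condition: the counting bound needs only that color spreads along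
  edges.\<close>

lemma colored_Suc_cases:
  assumes "w \<in> colored G S (Suc t)"
  shows "w \<in> colored G S t \<or> (\<exists>v\<in>colored G S t. w \<in> neighbors G v)"
  using assms by (cases t) (auto simp: closed_neighborhood_def force_step_def)

lemma colored_mono: "colored G S t \<subseteq> colored G S (Suc t)"
  by (cases t) (auto simp: closed_neighborhood_def force_step_def)

lemma colored_less:
  assumes "S \<subseteq> {..<n}"
  shows "colored G S t \<subseteq> {..<n}"
proof (induction t)
  case (Suc t)
  then show ?case using colored_Suc_cases neighbor_less by blast
qed (use assms in auto)

text \<open>Each timestep crosses at most one edge, which changes the offset \<open>d\<close> by at
  most 1. Signed offsets modulo \<open>n\<close> cover the wrap-around of the cycle, and the path as
  a special case.\<close>

lemma colored_near:
  assumes S: "S \<subseteq> {..<n}" and "w \<in> colored G S t"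
  shows "\<exists>s\<in>S. \<exists>d\<in>{-int t..int t}. int w = (int s + d) mod int n"
  using assms(2)
proof (induction t arbitrary: w)
  case 0
  then show ?case using S by (intro bexI[of _ w]) auto
next
  case (Suc t)
  from colored_Suc_cases[OF Suc.prems] show ?case
  proof
    assume "w \<in> colored G S t"
    then show ?thesis using Suc.IH[of w] by force
  next
    assume "\<exists>v\<in>colored G S t. w \<in> neighbors G v"
    then obtain v where v: "v \<in> colored G S t" "w \<in> neighbors G v" by blast
    obtain s d where sd: "s \<in> S" "d \<in> {-int t..int t}" "int v = (int s + d) mod int n"
      using Suc.IH[OF v(1)] by blast
    have w: "w < n" using neighbor_less[OF v(2)] .
    from neighbors_cyclic[OF v(2)] consider "w = (v + 1) mod n" | "v = (w + 1) mod n" by blast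
    then have "\<exists>e\<in>{-1, 1}. int w = (int v + e) mod int n"
    proof cases
      case 1
      then have "int w = (int v + 1) mod int n" by (simp only: zmod_int of_nat_add of_nat_1)
      then show ?thesis by blast
    next
      case 2
      then have "(int v + (- 1)) mod int n = (int w + 1 - 1) mod int n"
        by (simp add: zmod_int mod_diff_left_eq)
      then show ?thesis using w by (intro bexI[of _ "-1"]) auto
    qed
    then obtain e where e: "e \<in> {-1, 1}" "int w = (int v + e) mod int n" by blast
    have "int w = (int s + (d + e)) mod int n"
      unfolding e(2) sd(3) by (simp add: mod_add_left_eq add.assoc)
    moreover have "d + e \<in> {-int (Suc t)..int (Suc t)}" using sd(2) e(1) by auto
    ultimately show ?thesis using sd(1) by blast
  qed
qed

lemma card_colored_le:
  assumes S: "S \<subseteq> {..<n}"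
  shows "card (colored G S t) \<le> card S * (2 * t + 1)"
proof -
  have fin: "finite S" using S finite_subset by blast
  let ?f = "\<lambda>(s, d). nat ((int s + d) mod int n)"
  have "colored G S t \<subseteq> ?f ` (S \<times> {-int t..int t})"
  proof
    fix w assume "w \<in> colored G S t"
    then obtain s d where "s \<in> S" "d \<in> {-int t..int t}" "int w = (int s + d) mod int n"
      using colored_near[OF S] by blast
    then show "w \<in> ?f ` (S \<times> {-int t..int t})"
      by (intro image_eqI[of _ _ "(s, d)"]) (auto simp flip: \<open>int w = _\<close>)
  qed
  then have "card (colored G S t) \<le> card (S \<times> {-int t..int t})"
    using fin by (intro surj_card_le) auto
  also have "\<dots> = card S * (2 * t + 1)"
    by (simp add: card_cartesian_product nat_add_distrib nat_mult_distrib)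
  finally show ?thesis .
qed

text \<open>The inner vertex \<open>i + 1\<close> has only the neighbors \<open>i\<close> and
  \<open>i + 2\<close>; with \<open>i\<close> colored, \<open>i + 2\<close> is the only one it may
  still have to force.\<close>

lemma force_right:
  assumes "i \<in> C" "i + 1 \<in> C" "i + 2 < n"
  shows "i + 2 \<in> force_step G C"
proof (cases "i + 2 \<in> C")
  case False
  then have "neighbors G (i + 1) - C = {i + 2}"
    using assms neighbors_interior[OF assms(3)] by auto
  then show ?thesis using assms(2) unfolding force_step_def by blast
qed (simp add: force_step_def)

lemma force_left:
  assumes "i + 2 \<in> C" "i + 1 \<in> C" "i + 2 < n"
  shows "i \<in> force_step G C"
proof (cases "i \<in> C")
  case False
  then have "neighbors G (i + 1) - C = {i}"
    using assms neighbors_interior[OF assms(3)] by auto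
  then show ?thesis using assms(2) unfolding force_step_def by blast
qed (simp add: force_step_def)

text \<open>Color spreads both ways at full speed until it meets \<open>0\<close> or
  \<open>n - 1\<close>. Truncated subtraction and \<open>min\<close> cut the block off there, so no
  wrap-around arc is used.\<close>

lemma colored_block:
  assumes "s \<in> S" "s < n"
  shows "{s - t..min (s + t) (n - 1)} \<subseteq> colored G S t"
proof (induction t)
  case 0
  then show ?case using assms by auto
next
  case (Suc t)
  have old: "w \<in> colored G S (Suc t)" if "s - t \<le> w" "w \<le> s + t" "w < n" for w
    using that subsetD[OF Suc, of w] subsetD[OF colored_mono[of S t], of w] by simp
  \<comment> \<open>The first timestep colors all neighbors of \<open>s\<close>. Later ones must
    force, for which the two last vertices of the block colored so far suffice.\<close>
  have right: "s + Suc t \<in> colored G S (Suc t)" if lt: "s + Suc t < n"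
  proof (cases t)
    case 0
    then show ?thesis using assms lt right_neighbor[of s] by (auto simp: closed_neighborhood_def)
  next
    case (Suc u)
    have "s + u \<in> colored G S t" "s + u + 1 \<in> colored G S t"
      using Suc.IH lt Suc by auto
    then show ?thesis using force_right[of "s + u" "colored G S t"] Suc lt by simp
  qed
  \<comment> \<open>Writing \<open>s = i + Suc t\<close> avoids truncated subtraction: no such
    \<open>i\<close> exists once the block has reached \<open>0\<close>.\<close>
  have left: "i \<in> colored G S (Suc t)" if i: "s = i + Suc t" for i
  proof (cases t)
    case 0
    then show ?thesis using assms i left_neighbor[of i] by (auto simp: closed_neighborhood_def)
  next
    case (Suc u)
    have "i + 2 \<in> colored G S t" "i + 1 \<in> colored G S t"
      using Suc.IH i Suc assms by auto
    then show ?thesis using force_left[of i "colored G S t"] Suc i assms by simp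
  qed
  show ?case
  proof
    fix w assume "w \<in> {s - Suc t..min (s + Suc t) (n - 1)}"
    then have w: "s - Suc t \<le> w" "w \<le> s + Suc t" "w < n" using pos by auto
    then consider "w = s + Suc t" | "s = w + Suc t" | "s - t \<le> w" "w \<le> s + t" by linarith
    then show "w \<in> colored G S (Suc t)" using right left old w by cases auto
  qed
qed

lemma power_dominating_blocks:
  assumes "n \<le> s * (2 * t + 1)"
  obtains S where "power_dominating_set G S" "card S \<le> s" "ppt G S \<le> t"
proof -
  \<comment> \<open>The center of the \<open>j\<close>-th block of \<open>2 * t + 1\<close>
    vertices, capped so that it stays a vertex. Capped centers may coincide, hence only
    \<open>card S \<le> s\<close>.\<close>
  let ?c = "\<lambda>j. min (j * (2 * t + 1) + t) (n - 1)"
  define S where "S = ?c ` {..<s}"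
  have S: "S \<subseteq> {..<n}" using pos by (auto simp: S_def)
  have "{..<n} \<subseteq> colored G S t"
  proof
    fix w assume "w \<in> {..<n}"
    then have w: "w < n" by simp
    define j r where "j = w div (2 * t + 1)" and "r = w mod (2 * t + 1)"
    have w_eq: "w = j * (2 * t + 1) + r" and r: "r < 2 * t + 1"
      unfolding j_def r_def by (simp_all only: div_mult_mod_eq) simp
    have "w < s * (2 * t + 1)" using w assms by simp
    then have "j < s" unfolding j_def by (rule less_mult_imp_div_less)
    then have "?c j \<in> S" by (simp add: S_def)
    moreover have "?c j < n" using pos by auto
    \<comment> \<open>Capping moves a center only to the left, and never past the vertices
      \<open>w\<close> that remain to be covered on its right.\<close>
    moreover have "w \<in> {?c j - t..min (?c j + t) (n - 1)}"
      using w w_eq r by (auto simp: min_def)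
    ultimately show "w \<in> colored G S t" using colored_block by blast
  qed
  then have col: "colored G S t = pverts G" using colored_less[OF S] verts by blast
  show ?thesis
  proof
    show "power_dominating_set G S"
      using S col verts by (auto simp: power_dominating_set_def)
    show "card S \<le> s" unfolding S_def using card_image_le[of "{..<s}" ?c] by simp
    show "ppt G S \<le> t" unfolding ppt_def using col by (rule Least_le)
  qed
qed

lemma size_le_if_power_dominating:
  assumes "power_dominating_set G S"
  shows "n \<le> card S * (2 * ppt G S + 1)"
proof -
  have "\<exists>t. colored G S t = pverts G"
    using assms by (simp add: power_dominating_set_def)
  then have "colored G S (ppt G S) = pverts G"
    unfolding ppt_def by (rule LeastI_ex)
  then show ?thesis
    using card_colored_le[of S "ppt G S"] assms verts by (simp add: power_dominating_set_def)
qed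

theorem pd_throttling_eq: "int (pd_throttling G) = \<lceil>sqrt (2 * real n) - 1 / 2\<rceil>"
proof (rule antisym)
  let ?A = "{card S + ppt G S | S. power_dominating_set G S}"
  have fin: "finite ?A" and ne: "?A \<noteq> {}" using pd_throttling_set[of G] verts by auto
  show "\<lceil>sqrt (2 * real n) - 1 / 2\<rceil> \<le> int (pd_throttling G)"
  proof -
    have "pd_throttling G \<in> ?A" unfolding pd_throttling_def using Min_in[OF fin ne] .
    then obtain S where S: "power_dominating_set G S" and th: "pd_throttling G = card S + ppt G S"
      by blast
    let ?s = "real (card S)" and ?t = "real (ppt G S)"
    have "real n \<le> ?s * (2 * ?t + 1)"
      using of_nat_mono[OF size_le_if_power_dominating[OF S], where 'a = real]
      by (simp add: algebra_simps)
    \<comment> \<open>The arithmetic-geometric mean inequality for \<open>2 * ?s\<close> and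
      \<open>2 * ?t + 1\<close>.\<close>
    moreover have "0 \<le> (2 * ?s - (2 * ?t + 1))\<^sup>2" by simp
    ultimately have "2 * real n \<le> (?s + ?t + 1 / 2)\<^sup>2"
      by (simp add: power2_eq_square algebra_simps)
    then have "sqrt (2 * real n) \<le> ?s + ?t + 1 / 2" by (intro real_le_lsqrt) auto
    then show ?thesis using th by (simp add: ceiling_le_iff)
  qed
  show "int (pd_throttling G) \<le> \<lceil>sqrt (2 * real n) - 1 / 2\<rceil>"
  proof -
    define k where "k = nat \<lceil>sqrt (2 * real n) - 1 / 2\<rceil>"
    have "sqrt (2 * real n) \<ge> 0" by simp
    \<comment> \<open>A real above -1 has a nonnegative ceiling, so \<open>nat\<close> loses nothing
      in \<open>k\<close>.\<close>
    then have "- 1 < sqrt (2 * real n) - 1 / 2" by linarith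
    then have k: "int k = \<lceil>sqrt (2 * real n) - 1 / 2\<rceil>"
      unfolding k_def by (intro nat_0_le) (simp only: zero_le_ceiling)
    then have "sqrt (2 * real n) \<le> real k + 1 / 2"
      using le_of_int_ceiling[of "sqrt (2 * real n) - 1 / 2"] by (simp flip: k)
    then have "2 * real n \<le> (real k + 1 / 2)\<^sup>2" by (rule sqrt_le_D)
    then have "real (8 * n) \<le> real (4 * (k * (k + 1)) + 1)"
      by (simp add: power2_eq_square field_simps)
    then have n: "2 * n \<le> k * (k + 1)" unfolding of_nat_le_iff by presburger
    have "n \<le> ((k + 1) div 2) * (2 * (k div 2) + 1)"
    proof (cases "even k")
      case True
      then obtain m where "k = 2 * m" by blast
      then show ?thesis using n by (simp add: algebra_simps)
    next
      case False
      then obtain m where "k = 2 * m + 1" by (rule oddE)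
      then show ?thesis using n by (simp add: algebra_simps)
    qed
    then obtain S where S: "power_dominating_set G S" "card S \<le> (k + 1) div 2" "ppt G S \<le> k div 2"
      by (rule power_dominating_blocks)
    then have "pd_throttling G \<le> card S + ppt G S"
      unfolding pd_throttling_def by (intro Min_le fin) blast
    also have "\<dots> \<le> k" using S(2,3) by linarith
    finally show ?thesis using k by linarith
  qed
qed

end

lemma path_or_cycle_path_graph: "n \<ge> 1 \<Longrightarrow> path_or_cycle (path_graph n) n"
  by unfold_locales (auto simp: path_graph_def neighbors_def)

lemma path_or_cycle_cycle_graph: "n \<ge> 1 \<Longrightarrow> path_or_cycle (cycle_graph n) n"
  by unfold_locales (auto simp: cycle_graph_def neighbors_def)

theorem proposition7:
  shows "(\<forall>n::nat. n \<ge> 1 \<longrightarrow>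
            int (pd_throttling (path_graph n)) = \<lceil>sqrt (2 * real n) - 1 / 2\<rceil>) \<and>
         (\<forall>n::nat. n \<ge> 3 \<longrightarrow>
            int (pd_throttling (cycle_graph n)) = \<lceil>sqrt (2 * real n) - 1 / 2\<rceil>)"
  using path_or_cycle.pd_throttling_eq[OF path_or_cycle_path_graph]
    path_or_cycle.pd_throttling_eq[OF path_or_cycle_cycle_graph] by simp

end
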